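(* Let $\mathcal{X},\mathcal{Y},\mathcal{W}$ be Hilbert spaces, let $f:\mathcal{X}\to\mathbb{R}\cup\{+\infty\}$ and $g:\mathcal{Y}\to\mathbb{R}\cup\{+\infty\}$ be closed, proper and convex, let $A:\mathcal{X}\to\mathcal{W}$ and $B:\mathcal{Y}\to\mathcal{W}$ be bounded linear operators, and let $c\in\mathcal{W}$. Let $\rho>0$ and $\alpha\in(0,1)$. Suppose that sequences $(y(k)),(\psi(k)),(x(k)),(\xi(k)),(z(k))$, $k=0,1,2,\dots$, are generated by the five-equation R-ADMM recursion \begin{align*} y(k)&=\arg\min_{y\in\mathcal{Y}}\Big\{g(y)-\langle z(k),By-c\rangle+\tfrac{\rho}{2}\|By-c\|^2\Big\},\\ \psi(k)&=z(k)-\rho(By(k)-c),\\ x(k)&=\arg\min_{x\in\mathcal{X}}\Big\{f(x)-\langle 2\psi(k)-z(k),Ax\rangle+\tfrac{\rho}{2}\|Ax\|^2\Big\},\\ \xi(k)&=2\psi(k)-z(k)-\rho Ax(k),\\ z(k+1)&=z(k)+2\alpha(\xi(k)-\psi(k)). \end{align*} Then, setting $w(k)=\psi(k)$, for all $k\ge 0$ the sequences $(y(k)),(w(k)),(x(k))$ satisfy \begin{align*} y(k+1)&=\arg\min_{y\in\mathcal{Y}}\Big\{\mathcal{L}_\rho(x(k),y;w(k))+\rho(2\alpha-1)\langle By,\,Ax(k)+By(k)-c\rangle\Big\},\\ w(k+1)&=w(k)-\rho(Ax(k)+By(k+1)-c)-\rho(2\alpha-1)(Ax(k)+By(k)-c),\\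 x(k+1)&=\arg\min_{x\in\mathcal{X}}\mathcal{L}_\rho(x,y(k+1);w(k+1)). \end{align*} In particular, for $\alpha=1/2$ these are the standard ADMM updates \begin{align*} y(k+1)&=\arg\min_{y}\mathcal{L}_\rho(x(k),y;w(k)),\\ w(k+1)&=w(k)-\rho(Ax(k)+By(k+1)-c),\\ x(k+1)&=\arg\min_{x}\mathcal{L}_\rho(x,y(k+1);w(k+1)). \end{align*}
   Context: The underlying optimization problem is $\min_{x\in\mathcal{X},y\in\mathcal{Y}}\{f(x)+g(y)\}$ subject to $Ax+By=c$. Its augmented Lagrangian is $$\mathcal{L}_\rho(x,y;w)=f(x)+g(y)-\langle w,Ax+By-c\rangle+\tfrac{\rho}{2}\|Ax+By-c\|^2,$$ where $w\in\mathcal{W}$ is the multiplier. A function is closed if all its sublevel sets are closed. The convention is that $u=\arg\min_v h(v)$ means that $u$ is a minimizer of $h$ (the minimizers appearing in the recursion are assumed to exist). *)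

theory Defs
  imports "HOL-Analysis.Analysis"
begin

(* Functions into R \<union> {+\<infinity>} are ereal-valued functions that avoid -\<infinity>;
   "proper_fun" includes that condition. *)

definition proper_fun :: "('a \<Rightarrow> ereal) \<Rightarrow> bool" where
  "proper_fun f \<longleftrightarrow> (\<forall>x. f x \<noteq> -\<infinity>) \<and> (\<exists>x. f x \<noteq> \<infinity>)"

definition closed_fun :: "('a::topological_space \<Rightarrow> ereal) \<Rightarrow> bool" where
  "closed_fun f \<longleftrightarrow> (\<forall>a::real. closed {x. f x \<le> ereal a})"

(* Meant for functions avoiding -\<infinity>, so that the right-hand side is never \<infinity> - \<infinity>. *)
definition convex_fun :: "('a::real_vector \<Rightarrow> ereal) \<Rightarrow> bool" where
  "convex_fun f \<longleftrightarrow>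
     (\<forall>x y. \<forall>t::real. 0 < t \<and> t < 1 \<longrightarrow>
        f ((1 - t) *\<^sub>R x + t *\<^sub>R y) \<le> ereal (1 - t) * f x + ereal t * f y)"

definition aug_lagrangian ::
  "('x \<Rightarrow> ereal) \<Rightarrow> ('y \<Rightarrow> ereal) \<Rightarrow> ('x \<Rightarrow> 'w::real_inner) \<Rightarrow> ('y \<Rightarrow> 'w) \<Rightarrow> 'w \<Rightarrow> real
     \<Rightarrow> 'x \<Rightarrow> 'y \<Rightarrow> 'w \<Rightarrow> ereal" where
  "aug_lagrangian f g A B c \<rho> x y w =
     f x + g y - ereal (inner w (A x + B y - c)) + ereal (\<rho> / 2 * (norm (A x + B y - c))\<^sup>2)"

abbreviation is_minimizer :: "('a \<Rightarrow> ereal) \<Rightarrow> 'a \<Rightarrow> bool" where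
  "is_minimizer h u \<equiv> is_arg_min h (\<lambda>_. True) u"

end

theory Submission
  imports Defs
begin

text \<open>
  Eliminating \<open>\<xi>\<close> gives
  \<open>z (k+1) = w k - \<rho> A (x k) - \<rho> (2\<alpha> - 1) (A (x k) + B (y k) - c)\<close>.
  With this value of \<open>z (k+1)\<close>, the objectives of the \<open>y\<close>- and \<open>x\<close>-steps at \<open>k+1\<close> differ
  from the augmented Lagrangian objectives only by terms that do not depend on the variable of
  minimization. Adding such a constant preserves minimizers even when it is infinite.
\<close>

text \<open>Adding a fixed extended real is monotone. Only this direction holds in general: for
  \<open>C = \<infinity>\<close> every point minimizes \<open>G\<close>.\<close>

lemma is_minimizer_add_const:
  fixes F :: "'a \<Rightarrow> ereal"
  assumes "is_minimizer F u" and "\<And>v. G v = F v + C"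
  shows "is_minimizer G u"
  using assms by (auto simp: is_arg_min_linorder intro: add_right_mono)

text \<open>Confines the inner-product algebra to an identity between reals, so that infinite values
  occur only in the case split on \<open>p\<close> and \<open>q\<close>. In both uses
  \<open>q\<close> varies with the minimization variable and \<open>p\<close> is frozen.\<close>

lemma ereal_regroup:
  fixes p q :: ereal
  assumes "b - a + r = b' - a' + d"
  shows "p + q - ereal a + ereal b + ereal r = (q - ereal a' + ereal b') + (p + ereal d)"
proof -
  have "p + q - ereal a + ereal b + ereal r = p + q + ereal (b - a + r)"
    by (cases p; cases q) auto
  also have "\<dots> = (q - ereal a' + ereal b') + (p + ereal d)"
    unfolding assms by (cases p; cases q) auto
  finally show ?thesis .
qed

theorem mainTheorem1:
  fixes f :: "'x::{real_inner, complete_space} \<Rightarrow> ereal"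
    and g :: "'y::{real_inner, complete_space} \<Rightarrow> ereal"
    and A :: "'x \<Rightarrow> 'w::{real_inner, complete_space}"
    and B :: "'y \<Rightarrow> 'w"
    and c :: 'w
    and \<rho> \<alpha> :: real
    and x :: "nat \<Rightarrow> 'x" and y :: "nat \<Rightarrow> 'y"
    and \<psi> \<xi> z w :: "nat \<Rightarrow> 'w"
  assumes f: "closed_fun f" "proper_fun f" "convex_fun f"
    and g: "closed_fun g" "proper_fun g" "convex_fun g"
    and A: "bounded_linear A"
    and B: "bounded_linear B"
    and \<rho>: "\<rho> > 0"
    and \<alpha>: "0 < \<alpha>" "\<alpha> < 1"
    and y_step: "\<And>k. is_minimizer
          (\<lambda>v. g v - ereal (inner (z k) (B v - c)) + ereal (\<rho> / 2 * (norm (B v - c))\<^sup>2)) (y k)"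
    and \<psi>_step: "\<And>k. \<psi> k = z k - \<rho> *\<^sub>R (B (y k) - c)"
    and x_step: "\<And>k. is_minimizer
          (\<lambda>u. f u - ereal (inner (2 *\<^sub>R \<psi> k - z k) (A u)) + ereal (\<rho> / 2 * (norm (A u))\<^sup>2)) (x k)"
    and \<xi>_step: "\<And>k. \<xi> k = 2 *\<^sub>R \<psi> k - z k - \<rho> *\<^sub>R A (x k)"
    and z_step: "\<And>k. z (Suc k) = z k + (2 * \<alpha>) *\<^sub>R (\<xi> k - \<psi> k)"
    and w: "\<And>k. w k = \<psi> k"
  shows "(\<forall>k.
            is_minimizer
              (\<lambda>v. aug_lagrangian f g A B c \<rho> (x k) v (w k)
                   + ereal (\<rho> * (2 * \<alpha> - 1) * inner (B v) (A (x k) + B (y k) - c)))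
              (y (Suc k))
          \<and> w (Suc k) = w k - \<rho> *\<^sub>R (A (x k) + B (y (Suc k)) - c)
                        - (\<rho> * (2 * \<alpha> - 1)) *\<^sub>R (A (x k) + B (y k) - c)
          \<and> is_minimizer
              (\<lambda>u. aug_lagrangian f g A B c \<rho> u (y (Suc k)) (w (Suc k)))
              (x (Suc k)))
       \<and> (\<alpha> = 1 / 2 \<longrightarrow>
          (\<forall>k.
            is_minimizer (\<lambda>v. aug_lagrangian f g A B c \<rho> (x k) v (w k)) (y (Suc k))
          \<and> w (Suc k) = w k - \<rho> *\<^sub>R (A (x k) + B (y (Suc k)) - c)
          \<and> is_minimizer
              (\<lambda>u. aug_lagrangian f g A B c \<rho> u (y (Suc k)) (w (Suc k)))
              (x (Suc k))))"
proof -
  \<comment> \<open>With \<open>s = A (x k) + B (y k) - c\<close>, one has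
    \<open>\<xi> k - \<psi> k = - \<rho> s\<close> and
    \<open>z k = w k + \<rho> s - \<rho> A (x k)\<close>.\<close>
  have z_Suc: "z (Suc k) = w k - \<rho> *\<^sub>R A (x k) - (\<rho> * (2 * \<alpha> - 1)) *\<^sub>R (A (x k) + B (y k) - c)" for k
    unfolding z_step \<xi>_step w \<psi>_step by (simp add: algebra_simps flip: scaleR_2)
  have w_Suc: "w (Suc k) = w k - \<rho> *\<^sub>R (A (x k) + B (y (Suc k)) - c)
      - (\<rho> * (2 * \<alpha> - 1)) *\<^sub>R (A (x k) + B (y k) - c)" for k
    unfolding w[of "Suc k"] \<psi>_step[of "Suc k"] z_Suc by (simp add: algebra_simps)
  have y_min: "is_minimizer
      (\<lambda>v. aug_lagrangian f g A B c \<rho> (x k) v (w k)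
           + ereal (\<rho> * (2 * \<alpha> - 1) * inner (B v) (A (x k) + B (y k) - c)))
      (y (Suc k))" for k
  proof (rule is_minimizer_add_const[OF y_step])
    fix v
    define s where "s = A (x k) + B (y k) - c"
    define b where "b = B v - c"
    have Bv: "B v = b + c" and sum: "A (x k) + B v - c = A (x k) + b"
      by (simp_all add: b_def)
    \<comment> \<open>The cross term of the square,
      \<open>\<rho> \<langle>A (x k), b\<rangle>\<close>, and the \<open>b\<close>-part of the
      correction are exactly what turns \<open>w k\<close> into \<open>z (Suc k)\<close> in the
      linear term; the \<open>c\<close>-part of the correction is constant in
      \<open>v\<close>.\<close>
    show "aug_lagrangian f g A B c \<rho> (x k) v (w k)
        + ereal (\<rho> * (2 * \<alpha> - 1) * inner (B v) (A (x k) + B (y k) - c))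
      = g v - ereal (inner (z (Suc k)) (B v - c)) + ereal (\<rho> / 2 * (norm (B v - c))\<^sup>2)
        + (f (x k) + ereal (\<rho> / 2 * (norm (A (x k)))\<^sup>2 - inner (w k) (A (x k))
             + \<rho> * (2 * \<alpha> - 1) * inner c (A (x k) + B (y k) - c)))"
      unfolding aug_lagrangian_def sum z_Suc
      unfolding s_def[symmetric] b_def[symmetric] unfolding Bv
      by (rule ereal_regroup)
        (simp add: power2_norm_eq_inner inner_add_left inner_add_right inner_diff_left
          inner_diff_right inner_commute field_simps)
  qed
  \<comment> \<open>All quantities carry the same index, since the \<open>x\<close>-step involves
    only \<open>\<psi> k\<close> and \<open>z k\<close>; the conclusion uses this at
    \<open>Suc k\<close>.\<close>
  have x_min: "is_minimizer (\<lambda>u. aug_lagrangian f g A B c \<rho> u (y k) (w k)) (x k)" for k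
  proof -
    define b where "b = B (y k) - c"
    \<comment> \<open>The shift by \<open>\<rho> b\<close> accounts for the cross term of the square
      of \<open>A u + b\<close>.\<close>
    have reflect: "2 *\<^sub>R \<psi> k - z k = w k - \<rho> *\<^sub>R b"
      unfolding b_def w \<psi>_step scaleR_2 by (simp add: algebra_simps)
    have "aug_lagrangian f g A B c \<rho> u (y k) (w k)
      = f u - ereal (inner (2 *\<^sub>R \<psi> k - z k) (A u)) + ereal (\<rho> / 2 * (norm (A u))\<^sup>2)
        + (g (y k) + ereal (\<rho> / 2 * (norm b)\<^sup>2 - inner (w k) b))" for u
    proof -
      have sum: "A u + B (y k) - c = A u + b"
        by (simp add: b_def)
      \<comment> \<open>Swapping the summands and appending a zero correction fits the shape of
        \<open>ereal_regroup\<close>, now with \<open>g (y k)\<close> frozen.\<close>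
      have "aug_lagrangian f g A B c \<rho> u (y k) (w k)
        = g (y k) + f u - ereal (inner (w k) (A u + b)) + ereal (\<rho> / 2 * (norm (A u + b))\<^sup>2)
          + ereal 0"
        unfolding aug_lagrangian_def sum by (simp add: add.commute flip: zero_ereal_def)
      also have "\<dots> = f u - ereal (inner (2 *\<^sub>R \<psi> k - z k) (A u))
          + ereal (\<rho> / 2 * (norm (A u))\<^sup>2)
          + (g (y k) + ereal (\<rho> / 2 * (norm b)\<^sup>2 - inner (w k) b))"
        unfolding reflect
        by (rule ereal_regroup)
          (simp add: power2_norm_eq_inner inner_add_left inner_add_right inner_diff_left
            inner_diff_right inner_commute field_simps)
      finally show ?thesis .
    qed
    then show ?thesis
      by (rule is_minimizer_add_const[OF x_step])
  qed
  show ?thesis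
  proof (intro conjI allI impI)
    fix k
    assume half: "\<alpha> = 1 / 2"
    show "is_minimizer (\<lambda>v. aug_lagrangian f g A B c \<rho> (x k) v (w k)) (y (Suc k))"
      using y_min[of k] half by (simp flip: zero_ereal_def)
    show "w (Suc k) = w k - \<rho> *\<^sub>R (A (x k) + B (y (Suc k)) - c)"
      using w_Suc[of k] half by simp
  qed (rule y_min w_Suc x_min)+
qed

end
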